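(* Let $t\ge 3$ and $p\ge 2$ be integers, let $K_p^{(t)}$ be the complete $t$-partite graph with all parts of size $p$, and let $G_{t,p}=K_p^{(t)}-e$ where $e$ is an edge. Put $r=p(t-1)$, $a=\frac{r(r-1)}{2r-1}$ and $b=\frac r2$. Then the $ISI$ spectrum of $G_{t,p}$ is $$\operatorname{Spec}(ISI(G_{t,p}))=\Big\{0^{[pt-t-2]},\;(-bp)^{[t-3]},\;\lambda_+,\lambda_-,\;\mu_1,\mu_2,\mu_3\Big\},$$ where $$\lambda_{\pm}=\frac{-b(p-1)\pm\sqrt{b^2(p-1)^2+4a^2(p-1)}}{2},$$ and $\mu_1,\mu_2,\mu_3$ are the eigenvalues of $$M_{t,p}=\begin{pmatrix}0&a(p-1)&ap(t-2)\\ a&b(p-1)&bp(t-2)\\ 2a&2b(p-1)&bp(t-3)\end{pmatrix}.$$ In particular, $$\det(M_{t,p})=\frac{p^4(p-1)(t-1)^4(pt-p-1)^2}{2(2pt-2p-1)^2}>0,$$ so none of $\mu_1,\mu_2,\mu_3$ is zero.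
   Context: For a finite simple graph $G$ with vertices $v_1,\dots,v_n$ of degrees $d_1,\dots,d_n$, the inverse sum indeg matrix $ISI(G)$ is the $n\times n$ real symmetric matrix whose $(i,j)$ entry is $\frac{d_id_j}{d_i+d_j}$ if $v_i$ and $v_j$ are adjacent, and $0$ otherwise. $\operatorname{Spec}(M)$ is the multiset of eigenvalues of $M$; $\lambda^{[k]}$ means $\lambda$ repeated with multiplicity $k$. $G-e$ is obtained by deleting the edge $e$ (keeping all vertices); $ISI(G-e)$ is computed with the degrees of $G-e$. *)

theory Defs
  imports Complex_Main "Jordan_Normal_Form.Char_Poly"
begin

(* A graph is a pair (V, E) of a vertex set and a set of two-element edges. *)
type_synonym 'a graph = "'a set \<times> 'a set set"

abbreviation verts :: "'a graph \<Rightarrow> 'a set" where "verts \<equiv> fst"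
abbreviation edges :: "'a graph \<Rightarrow> 'a set set" where "edges \<equiv> snd"

definition simple_graph :: "'a graph \<Rightarrow> bool" where
  "simple_graph G \<longleftrightarrow> finite (verts G) \<and> (\<forall>e\<in>edges G. e \<subseteq> verts G \<and> card e = 2)"

definition adjacent :: "'a graph \<Rightarrow> 'a \<Rightarrow> 'a \<Rightarrow> bool" where
  "adjacent G u v \<longleftrightarrow> {u, v} \<in> edges G"

definition vdegree :: "'a graph \<Rightarrow> 'a \<Rightarrow> nat" where
  "vdegree G v = card {w \<in> verts G. adjacent G v w}"

definition delete_edge :: "'a graph \<Rightarrow> 'a set \<Rightarrow> 'a graph" where
  "delete_edge G e = (verts G, edges G - {e})"

(* The vertices are the pairs (i, k) with i < t and k < p; the part of (i, k) is i. *)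
definition complete_multipartite :: "nat \<Rightarrow> nat \<Rightarrow> (nat \<times> nat) graph" where
  "complete_multipartite t p =
     (let V = {..<t} \<times> {..<p}
      in (V, {{u, v} | u v. u \<in> V \<and> v \<in> V \<and> fst u \<noteq> fst v}))"

(* The list vs plays the role of the enumeration v_1, ..., v_n of the vertices. *)
definition ISI :: "'a graph \<Rightarrow> 'a list \<Rightarrow> real mat" where
  "ISI G vs = mat (length vs) (length vs) (\<lambda>(i, j).
     if adjacent G (vs ! i) (vs ! j)
     then real (vdegree G (vs ! i)) * real (vdegree G (vs ! j))
            / (real (vdegree G (vs ! i)) + real (vdegree G (vs ! j)))
     else 0)"

(* The eigenvalues are taken in the complex numbers, each repeated according to its
   algebraic multiplicity, so that no eigenvalue of a non-symmetric matrix is lost. *)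
definition Spec :: "real mat \<Rightarrow> complex multiset" where
  "Spec A = proots (char_poly (map_mat complex_of_real A))"

lemma simple_graph_complete_multipartite: "simple_graph (complete_multipartite t p)"
  by (auto simp: simple_graph_def complete_multipartite_def Let_def card_2_iff)

lemma simple_graph_delete_edge: "simple_graph G \<Longrightarrow> simple_graph (delete_edge G e)"
  by (auto simp: simple_graph_def delete_edge_def)

end

theory Submission
  imports Defs
begin

text \<open>
  Write e = {u, v}. In G only u and v have degree r - 1, every other vertex has degree r, so the
  entry of the ISI matrix at two vertices of different parts is a if exactly one of them is u or v,
  b if neither is, and 0 for the pair u, v itself. The matrix therefore acts simply on functions
  that are constant on each part away from u and v, and a basis of the function space adapted to
  the symmetries of G puts it into a block diagonal form.

  The vertices fall into three orbits of the automorphism group: {u, v}, the rest of the two parts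
  that meet e, and the remaining t - 2 parts. The indicators of the three orbits span an invariant
  subspace on which the ISI matrix acts by M. All other basis elements are eigenfunctions:
    \<^item> functions that change sign when the parts of u and v are exchanged, with eigenvalues \<open>\<lambda>\<^sub>+\<close> and
      \<open>\<lambda>\<^sub>-\<close> (\<open>skew\<close>);
    \<^item> differences of the indicators of two parts that do not meet e, with eigenvalue - b p
      (\<open>part_diff\<close>);
    \<^item> differences of the indicators of two vertices with the same neighbourhood, with eigenvalue 0
      (\<open>twin_diff\<close>).
  These are as many functions as there are vertices, and a function orthogonal to all of them
  vanishes (\<open>orthogonal_to_basis_imp_zero\<close>), so they form a basis and the characteristic polynomial
  of the ISI matrix is that of M times the linear factors of the eigenvalues above
  (\<open>char_poly_invariant_block_eigenfunctions\<close>, \<open>char_poly_ISI\<close>). M is kept as a block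
  because its eigenvalues have no simple closed form and may coincide with others in the list, so
  that eigenvectors for them would not obviously complete the basis.
  Finally, det M is positive, hence 0 is not an eigenvalue of M.
\<close>

section \<open>Characteristic polynomials and spectra\<close>

lemma char_poly_four_block_diag:
  fixes A :: "'a :: idom mat"
  assumes A: "A \<in> carrier_mat k k" and D: "D \<in> carrier_mat m m"
  shows "char_poly (four_block_mat A (0\<^sub>m k m) (0\<^sub>m m k) D) = char_poly A * char_poly D"
proof -
  have "char_poly_matrix (four_block_mat A (0\<^sub>m k m) (0\<^sub>m m k) D)
      = four_block_mat (char_poly_matrix A) (0\<^sub>m k m) (0\<^sub>m m k) (char_poly_matrix D)"
    using A D by (intro eq_matI) (auto simp: char_poly_matrix_def)
  moreover have "det (four_block_mat (char_poly_matrix A) (0\<^sub>m k m) (0\<^sub>m m k) (char_poly_matrix D))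
      = det (char_poly_matrix A) * det (char_poly_matrix D)"
    using A D by (intro det_four_block_mat_lower_left_zero) auto
  ultimately show ?thesis by (simp add: char_poly_def)
qed

text \<open>
  Injectivity is asked of the transpose of P because that is a condition on the inner products with
  the columns of P one at a time, which is easy to check for an explicit basis.
\<close>
lemma char_poly_similar_intertwine:
  fixes A T P :: "'a :: field mat"
  assumes A: "A \<in> carrier_mat n n" and T: "T \<in> carrier_mat n n" and P: "P \<in> carrier_mat n n"
    and AP: "A * P = P * T"
    and inj: "\<And>y. y \<in> carrier_vec n \<Longrightarrow> P\<^sup>T *\<^sub>v y = 0\<^sub>v n \<Longrightarrow> y = 0\<^sub>v n"
  shows "char_poly A = char_poly T"
proof -
  have "det P\<^sup>T \<noteq> 0"
    using inj P by (subst det_0_iff_vec_prod_zero[of _ n]) auto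
  then have "det P \<noteq> 0" using det_transpose[OF P] by simp
  from det_non_zero_imp_unit[OF P this, of "()"]
  obtain Q where Q: "Q \<in> carrier_mat n n" and QP: "Q * P = 1\<^sub>m n" and PQ: "P * Q = 1\<^sub>m n"
    by (auto simp: Units_def ring_mat_def)
  have "A = A * (P * Q)" using A PQ by simp
  also have "\<dots> = P * T * Q" using A P Q AP by (simp flip: assoc_mult_mat)
  finally have "similar_mat A T"
    using A P Q T PQ QP by (intro similar_matI[of _ _ P Q n]) auto
  then show ?thesis by (rule char_poly_similar)
qed

text \<open>
  A block diagonalisation stated for functions on the index set instead of vectors: the functions in
  bs span an invariant subspace on which K acts by M, those in ds are eigenfunctions, and nothing
  but 0 is orthogonal to all of them. The enumeration vs only serves to number the rows, and the
  columns are numbered by the basis, so that the order of vs never has to be adapted to the blocks.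
\<close>
lemma char_poly_invariant_block_eigenfunctions:
  fixes K :: "'v \<Rightarrow> 'v \<Rightarrow> 'a :: field"
  assumes "distinct vs" and len: "length bs + length ds = length vs"
    and M: "M \<in> carrier_mat (length bs) (length bs)"
    and inv: "\<And>j w. j < length bs \<Longrightarrow> w \<in> set vs \<Longrightarrow>
        (\<Sum>x\<in>set vs. K w x * (bs ! j) x) = (\<Sum>l<length bs. (bs ! l) w * M $$ (l, j))"
    and eig: "\<And>d f w. (d, f) \<in> set ds \<Longrightarrow> w \<in> set vs \<Longrightarrow> (\<Sum>x\<in>set vs. K w x * f x) = d * f w"
    and indep: "\<And>y w. (\<And>f. f \<in> set bs \<union> snd ` set ds \<Longrightarrow> (\<Sum>x\<in>set vs. y x * f x) = 0) \<Longrightarrow>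
        w \<in> set vs \<Longrightarrow> y w = 0"
  shows "char_poly (mat (length vs) (length vs) (\<lambda>(i, j). K (vs ! i) (vs ! j)))
       = char_poly M * (\<Prod>d\<leftarrow>map fst ds. [:- d, 1:])"
proof -
  define n k m where "n = length vs" and "k = length bs" and "m = length ds"
  have nkm: "n = k + m" using len by (simp add: n_def k_def m_def)
  \<comment> \<open>The columns of the change of basis P, in which the matrix A takes the form T.\<close>
  define c where "c j = (if j < k then bs ! j else snd (ds ! (j - k)))" for j
  define A where "A = mat n n (\<lambda>(i, j). K (vs ! i) (vs ! j))"
  define P where "P = mat n n (\<lambda>(i, j). c j (vs ! i))"
  define D where "D = mat m m (\<lambda>(i, j). if i = j then fst (ds ! i) else 0)"
  define T where "T = four_block_mat M (0\<^sub>m k m) (0\<^sub>m m k) D"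
  have M': "M \<in> carrier_mat k k" using M by (simp add: k_def)
  have D: "D \<in> carrier_mat m m" by (simp add: D_def)
  have T: "T \<in> carrier_mat n n" using M' D by (auto simp: T_def nkm)
  have reindex: "(\<Sum>i<n. g (vs ! i)) = (\<Sum>x\<in>set vs. g x)" for g :: "'v \<Rightarrow> 'a"
    using sum.reindex_bij_betw[OF bij_betw_nth[OF \<open>distinct vs\<close> refl refl], of g]
    by (simp add: n_def)
  have nth_vs: "vs ! i \<in> set vs" if "i < n" for i using that by (simp add: n_def)
  \<comment> \<open>Column j of this equation is inv for j < k and eig otherwise.\<close>
  have AP: "A * P = P * T"
  proof (rule eq_matI)
    fix i j assume "i < dim_row (P * T)" "j < dim_col (P * T)"
    then have ij: "i < n" "j < n" using T by (auto simp: P_def)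
    have "(A * P) $$ (i, j) = (\<Sum>x<n. K (vs ! i) (vs ! x) * c j (vs ! x))"
      using ij by (simp add: A_def P_def scalar_prod_def atLeast0LessThan)
    also have "\<dots> = (\<Sum>x\<in>set vs. K (vs ! i) x * c j x)" by (rule reindex)
    also have "\<dots> = (\<Sum>l<n. c l (vs ! i) * T $$ (l, j))"
    proof (cases "j < k")
      case True
      have "(\<Sum>x\<in>set vs. K (vs ! i) x * c j x) = (\<Sum>l<k. c l (vs ! i) * T $$ (l, j))"
        using True ij M' inv[of j "vs ! i"] nth_vs by (simp add: c_def T_def k_def)
      also have "\<dots> = (\<Sum>l<n. c l (vs ! i) * T $$ (l, j))"
        using True ij M' D by (intro sum.mono_neutral_left) (auto simp: T_def nkm)
      finally show ?thesis .
    next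
      case False
      then have jm: "j - k < m" using ij nkm by simp
      then have "(fst (ds ! (j - k)), snd (ds ! (j - k))) \<in> set ds" by (simp add: m_def)
      from eig[OF this nth_vs[OF ij(1)]]
      have "(\<Sum>x\<in>set vs. K (vs ! i) x * c j x) = c j (vs ! i) * fst (ds ! (j - k))"
        using False by (simp add: c_def mult.commute)
      also have "\<dots> = (\<Sum>l<n. if l = j then c l (vs ! i) * fst (ds ! (j - k)) else 0)"
        using ij by simp
      also have "\<dots> = (\<Sum>l<n. c l (vs ! i) * T $$ (l, j))"
        using False ij M' D jm by (intro sum.cong) (auto simp: T_def D_def nkm)
      finally show ?thesis .
    qed
    also have "\<dots> = (P * T) $$ (i, j)"
      using ij T by (simp add: P_def scalar_prod_def atLeast0LessThan)
    finally show "(A * P) $$ (i, j) = (P * T) $$ (i, j)" .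
  qed (use T in \<open>auto simp: A_def P_def\<close>)
  have "char_poly A = char_poly T"
  proof (rule char_poly_similar_intertwine[OF _ T _ AP])
    fix y :: "'a vec" assume y: "y \<in> carrier_vec n" and Py: "P\<^sup>T *\<^sub>v y = 0\<^sub>v n"
    \<comment> \<open>The vector y read as a function on the index set.\<close>
    define y' where "y' x = y $ (the_inv_into {..<n} ((!) vs) x)" for x
    have inj: "inj_on ((!) vs) {..<n}"
      using \<open>distinct vs\<close> by (simp add: n_def inj_on_nth)
    have y': "y' (vs ! i) = y $ i" if "i < n" for i
      using the_inv_into_f_f[OF inj, of i] that by (simp add: y'_def)
    have c0: "(\<Sum>x\<in>set vs. y' x * c j x) = 0" if "j < n" for j
    proof -
      have "0 = (P\<^sup>T *\<^sub>v y) $ j" using Py that by simp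
      also have "\<dots> = (\<Sum>i<n. c j (vs ! i) * y $ i)"
        using that y by (simp add: P_def scalar_prod_def atLeast0LessThan)
      also have "\<dots> = (\<Sum>i<n. y' (vs ! i) * c j (vs ! i))"
        by (intro sum.cong) (auto simp: y')
      also have "\<dots> = (\<Sum>x\<in>set vs. y' x * c j x)" by (rule reindex)
      finally show ?thesis by simp
    qed
    have "(\<Sum>x\<in>set vs. y' x * f x) = 0" if f: "f \<in> set bs \<union> snd ` set ds" for f
    proof -
      have "\<exists>j<n. c j = f"
        using f
      proof
        assume "f \<in> set bs"
        then obtain j where "j < k" "f = bs ! j" by (auto simp: in_set_conv_nth k_def)
        then show ?thesis by (intro exI[of _ j]) (auto simp: c_def nkm)
      next
        assume "f \<in> snd ` set ds"
        then obtain j where "j < m" "f = snd (ds ! j)" by (metis imageE in_set_conv_nth m_def)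
        then show ?thesis by (intro exI[of _ "k + j"]) (auto simp: c_def nkm)
      qed
      then show ?thesis using c0 by blast
    qed
    then have "y' w = 0" if "w \<in> set vs" for w using indep that by blast
    then have "y $ i = 0" if "i < n" for i using y'[OF that] nth_vs[OF that] by simp
    then show "y = 0\<^sub>v n" using y by (intro eq_vecI) auto
  qed (auto simp: A_def P_def)
  also have "\<dots> = char_poly M * char_poly D"
    unfolding T_def by (rule char_poly_four_block_diag[OF M' D])
  also have "char_poly D = (\<Prod>d\<leftarrow>diag_mat D. [:- d, 1:])"
    by (rule char_poly_upper_triangular[OF D]) (auto simp: D_def)
  also have "diag_mat D = map fst ds"
    by (rule nth_equalityI) (auto simp: diag_mat_def D_def m_def)
  finally show ?thesis by (simp add: A_def n_def)
qed

lemma det_mat_of_rows_list_3: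
  fixes a11 :: "'a :: comm_ring_1"
  shows "det (mat_of_rows_list 3 [[a11, a12, a13], [a21, a22, a23], [a31, a32, a33]])
    = a11 * (a22 * a33 - a23 * a32) - a21 * (a12 * a33 - a13 * a32) + a31 * (a12 * a23 - a13 * a22)"
proof -
  have det2: "det (mat 2 2 g) = g (0, 0) * g (1, 1) - g (1, 0) * g (0, 1)" for g :: "nat \<times> nat \<Rightarrow> 'a"
    by (subst laplace_expansion_column[of _ 2 0])
       (auto simp: cofactor_def mat_delete_def det_single numeral_2_eq_2 lessThan_Suc)
  have "mat_delete (mat 3 3 g) i j = mat 2 2 (\<lambda>(i', j').
      g (if i' < i then i' else Suc i', if j' < j then j' else Suc j'))" for g :: "nat \<times> nat \<Rightarrow> 'a" and i j
    by (auto simp: mat_delete_def intro!: eq_matI)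
  then show ?thesis
    by (subst laplace_expansion_column[of _ 3 0])
       (simp_all add: mat_of_rows_list_def cofactor_def det2 lessThan_nat_numeral algebra_simps
         lessThan_Suc numeral_3_eq_3)
qed

lemma proots_prod_list_linear:
  "proots (\<Prod>d\<leftarrow>ds. [:- d, 1:]) = mset (ds :: complex list)"
proof (induction ds)
  case (Cons d ds)
  have "(\<Prod>d\<leftarrow>ds. [:- d, 1:]) \<noteq> 0" by (auto simp: prod_list_zero_iff)
  then have "proots ([:- d, 1:] * (\<Prod>d\<leftarrow>ds. [:- d, 1:]))
      = proots [:- d, 1:] + proots (\<Prod>d\<leftarrow>ds. [:- d, 1:])"
    by (intro proots_mult) auto
  with Cons show ?case by simp
qed simp

lemma det_0_if_0_in_Spec:
  assumes "A \<in> carrier_mat n n" and "0 \<in># Spec A"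
  shows "det A = 0"
proof -
  let ?C = "map_mat complex_of_real A"
  have C: "?C \<in> carrier_mat n n" using assms(1) by simp
  have "char_poly ?C \<noteq> 0" using degree_monic_char_poly[OF C] by auto
  then have "poly (char_poly ?C) 0 = 0" using assms(2) by (simp add: Spec_def)
  then have "eigenvalue ?C 0" using eigenvalue_root_char_poly[OF C] by simp
  then obtain v where v: "v \<in> carrier_vec n" "v \<noteq> 0\<^sub>v n" "?C *\<^sub>v v = 0 \<cdot>\<^sub>v v"
    using assms(1) by (auto simp: eigenvalue_def eigenvector_def)
  then have "?C *\<^sub>v v = 0\<^sub>v n" by auto
  with v(1,2) have "det ?C = 0" using det_0_iff_vec_prod_zero[OF C] by blast
  then show ?thesis by (simp add: of_real_hom.hom_det)
qed

text \<open>
  Factorisations are found over the reals, where the ISI matrix lives, and transferred to the complex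
  spectrum here. The roots of the factor that belongs to M stay together as Spec M.
\<close>
lemma Spec_if_char_poly_factors:
  assumes A: "A \<in> carrier_mat n n" and M: "M \<in> carrier_mat k k"
    and "char_poly A = char_poly M * (\<Prod>d\<leftarrow>ds. [:- d, 1:])"
  shows "Spec A = Spec M + mset (map complex_of_real ds)"
proof -
  interpret h: map_poly_inj_idom_hom complex_of_real ..
  have "char_poly (map_mat complex_of_real A) = map_poly complex_of_real (char_poly A)"
    by (rule of_real_hom.char_poly_hom[OF A])
  also have "\<dots> = map_poly complex_of_real (char_poly M) * (\<Prod>d\<leftarrow>map complex_of_real ds. [:- d, 1:])"
    unfolding assms(3) h.hom_mult
    by (rule arg_cong[where f = "(*) _"], induction ds)
       (simp_all only: list.map prod_list.Nil prod_list.Cons h.hom_mult h.hom_one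
         of_real_hom.map_poly_pCons_hom map_poly_0 of_real_hom.hom_uminus of_real_1)
  also have "map_poly complex_of_real (char_poly M) = char_poly (map_mat complex_of_real M)"
    by (rule of_real_hom.char_poly_hom[OF M, symmetric])
  finally have "char_poly (map_mat complex_of_real A)
    = char_poly (map_mat complex_of_real M) * (\<Prod>d\<leftarrow>map complex_of_real ds. [:- d, 1:])" .
  moreover have "char_poly (map_mat complex_of_real A) \<noteq> 0"
    using degree_monic_char_poly[of "map_mat complex_of_real A" n] A by auto
  ultimately show ?thesis
    by (simp add: Spec_def proots_mult proots_prod_list_linear del: map_map)
qed

lemma Spec_3:
  assumes "M \<in> carrier_mat 3 3"
  obtains x y z where "Spec M = {#x, y, z#}"
proof -
  have "size (Spec M) = 3"
    using degree_monic_char_poly[of "map_mat complex_of_real M" 3] assms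
    by (simp add: Spec_def size_proots_complex)
  moreover have "\<exists>x N'. N = add_mset x N' \<and> size N' = k" if "size N = Suc k"
    for N :: "complex multiset" and k
    using size_eq_Suc_imp_eq_union[OF that] that by (metis add_left_cancel plus_1_eq_Suc size_add_mset)
  ultimately obtain x y z where "Spec M = {#x, y, z#}"
    unfolding numeral_3_eq_3 by (metis size_eq_0_iff_empty)
  then show ?thesis by (rule that)
qed

section \<open>Quadratic roots and a sum over the parts\<close>

lemma quadratic_roots:
  fixes \<beta> \<gamma> :: real
  assumes "\<beta>\<^sup>2 + 4 * \<gamma> \<ge> 0" and "l = (- \<beta> + s * sqrt (\<beta>\<^sup>2 + 4 * \<gamma>)) / 2" and "s\<^sup>2 = 1"
  shows "l\<^sup>2 + \<beta> * l = \<gamma>"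
proof -
  have "2 * l + \<beta> = s * sqrt (\<beta>\<^sup>2 + 4 * \<gamma>)" using assms(2) by (simp add: field_simps)
  then have "(2 * l + \<beta>)\<^sup>2 = s\<^sup>2 * (sqrt (\<beta>\<^sup>2 + 4 * \<gamma>))\<^sup>2" by (simp add: power_mult_distrib)
  also have "\<dots> = \<beta>\<^sup>2 + 4 * \<gamma>" using assms by simp
  finally show ?thesis by (simp add: power2_eq_square algebra_simps)
qed

lemma sum_lessThan_if2:
  fixes \<alpha> \<beta> t :: nat
  assumes "\<alpha> < t" "\<beta> < t" "\<alpha> \<noteq> \<beta>"
  shows "(\<Sum>i<t. if i = \<alpha> then x else if i = \<beta> then y else z i) = x + y + (\<Sum>i\<in>{..<t} - {\<alpha>, \<beta>}. z i :: real)"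
proof -
  have "{..<t} = insert \<alpha> (insert \<beta> ({..<t} - {\<alpha>, \<beta>}))" using assms by auto
  then have "(\<Sum>i<t. if i = \<alpha> then x else if i = \<beta> then y else z i)
      = (\<Sum>i\<in>insert \<alpha> (insert \<beta> ({..<t} - {\<alpha>, \<beta>})). if i = \<alpha> then x else if i = \<beta> then y else z i)" by simp
  also have "\<dots> = x + (y + (\<Sum>i\<in>{..<t} - {\<alpha>, \<beta>}. if i = \<alpha> then x else if i = \<beta> then y else z i))"
    using assms by (subst sum.insert; simp)+
  also have "(\<Sum>i\<in>{..<t} - {\<alpha>, \<beta>}. if i = \<alpha> then x else if i = \<beta> then y else z i) = (\<Sum>i\<in>{..<t} - {\<alpha>, \<beta>}. z i)"
    by (intro sum.cong) auto
  finally show ?thesis by simp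
qed

section \<open>The complete multipartite graph without an edge\<close>

text \<open>
  The deleted edge is an unordered pair. Naming its end points makes it possible to write down
  functions that are antisymmetric in them.
\<close>
locale multipartite_minus_edge =
  fixes t p :: nat and u v :: "nat \<times> nat"
  assumes t3: "t \<ge> 3" and p2: "p \<ge> 2"
    and u: "u \<in> {..<t} \<times> {..<p}" and v: "v \<in> {..<t} \<times> {..<p}" and uv: "fst u \<noteq> fst v"
begin

definition V :: "(nat \<times> nat) set" where "V = {..<t} \<times> {..<p}"
definition ordinary :: "(nat \<times> nat) set" where "ordinary = V - {u, v}"
definition r :: real where "r = real p * (real t - 1)"
definition a :: real where "a = r * (r - 1) / (2 * r - 1)"
definition b :: real where "b = r / 2"

text \<open>
  The size of a part after u and v have been removed from it.
\<close>
definition part_size :: "nat \<Rightarrow> real" where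
  "part_size i = (if i = fst u \<or> i = fst v then real p - 1 else real p)"

text \<open>
  The entries of the ISI matrix of G in closed form; see \<open>ISI_G\<close>.
\<close>
definition weight :: "nat \<times> nat \<Rightarrow> nat \<times> nat \<Rightarrow> real" where
  "weight w x = (if fst w = fst x then 0
     else if w \<in> {u, v} then (if x \<in> {u, v} then 0 else a)
     else (if x \<in> {u, v} then a else b))"

lemma uv_neq: "u \<noteq> v" using uv by auto
lemma fst_uv: "fst u < t" "fst v < t" using u v by auto
lemma uv_V: "u \<in> V" "v \<in> V" using u v by (auto simp: V_def)
lemma finite_V: "finite V" by (simp add: V_def)

lemma r_ge: "r \<ge> 4"
proof -
  have "2 * 2 \<le> real p * (real t - 1)" using t3 p2 by (intro mult_mono) auto
  then show ?thesis by (simp add: r_def)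
qed

lemma a_pos: "a > 0" and b_pos: "b > 0" using r_ge by (auto simp: a_def b_def)

lemma ordinary_part: "{x \<in> ordinary. fst x = i} =
  {i} \<times> ({..<p} - (if i = fst u then {snd u} else if i = fst v then {snd v} else {}))" if "i < t"
  using that uv by (auto simp: ordinary_def V_def prod_eq_iff split: if_splits)

lemma card_ordinary_part: "real (card {x \<in> ordinary. fst x = i}) = part_size i" if "i < t"
  unfolding ordinary_part[OF that] card_cartesian_product part_size_def using u v p2
  by (auto simp: card_Diff_subset of_nat_diff)

section \<open>The ISI operator on functions that are constant on parts\<close>

lemma sum_partwise:
  assumes "\<And>x. x \<in> ordinary \<Longrightarrow> f x = c (fst x)"
  shows "(\<Sum>x\<in>V. f x) = f u + f v + (\<Sum>i<t. part_size i * c i :: real)"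
proof -
  have "V = insert u (insert v ordinary)" using uv_V by (auto simp: ordinary_def)
  moreover have "finite ordinary" using finite_V by (simp add: ordinary_def)
  ultimately have "(\<Sum>x\<in>V. f x) = f u + (f v + (\<Sum>x\<in>ordinary. f x))"
    using uv_neq
    by (metis DiffE finite.insertI finite_V finite_insert insertI1 insertI2 insertE ordinary_def sum.insert)
  also have "(\<Sum>x\<in>ordinary. f x) = (\<Sum>i<t. \<Sum>x\<in>{x\<in>ordinary. fst x = i}. f x)"
    by (rule sum.group[symmetric]) (auto simp: ordinary_def V_def)
  also have "\<dots> = (\<Sum>i<t. part_size i * c i)"
  proof (intro sum.cong refl)
    fix i assume "i \<in> {..<t}"
    have "(\<Sum>x\<in>{x\<in>ordinary. fst x = i}. f x) = (\<Sum>x\<in>{x\<in>ordinary. fst x = i}. c i)"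
      using assms by (intro sum.cong) auto
    then show "(\<Sum>x\<in>{x\<in>ordinary. fst x = i}. f x) = part_size i * c i"
      using card_ordinary_part \<open>i \<in> {..<t}\<close> by simp
  qed
  finally show ?thesis by simp
qed

text \<open>
  Away from its own part an ordinary vertex sees every vertex with a weight that only tells u and v
  from the rest, so that the image is determined by the total s, the share of the own part in it,
  and the values at u and v. All eigenvalue computations but the one for twins are instances.
\<close>
lemma weight_sum_partwise:
  assumes f: "\<And>x. x \<in> ordinary \<Longrightarrow> f x = c (fst x)" and s: "(\<Sum>i<t. part_size i * c i) = s" and w: "w \<in> V"
  shows "(\<Sum>x\<in>V. weight w x * f x) =
    (if w = u then a * (s - part_size (fst u) * c (fst u))
     else if w = v then a * (s - part_size (fst v) * c (fst v))
     else a * ((if fst w = fst u then 0 else f u) + (if fst w = fst v then 0 else f v))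
       + b * (s - part_size (fst w) * c (fst w)))"
proof -
  define k where "k = (if w \<in> {u, v} then a else b)"
  have wt: "fst w < t" using w by (auto simp: V_def)
  have "(\<Sum>x\<in>V. weight w x * f x) = weight w u * f u + weight w v * f v
      + (\<Sum>i<t. part_size i * (if i = fst w then 0 else k * c i))"
    by (rule sum_partwise) (auto simp: weight_def f ordinary_def k_def)
  also have "(\<Sum>i<t. part_size i * (if i = fst w then 0 else k * c i))
      = (\<Sum>i<t. k * (part_size i * c i) - (if i = fst w then k * (part_size i * c i) else 0))"
    by (intro sum.cong) auto
  also have "\<dots> = k * (s - part_size (fst w) * c (fst w))"
    using wt by (simp add: s[symmetric] sum_subtractf sum_distrib_left right_diff_distrib)
  finally show ?thesis using uv by (auto simp: weight_def k_def algebra_simps)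
qed

section \<open>The adapted basis\<close>

definition pair_ind :: "nat \<times> nat \<Rightarrow> real" where
  "pair_ind x = (if x \<in> {u, v} then 1 else 0)"
definition cut_ind :: "nat \<times> nat \<Rightarrow> real" where
  "cut_ind x = (if x \<notin> {u, v} \<and> fst x \<in> {fst u, fst v} then 1 else 0)"
definition rest_ind :: "nat \<times> nat \<Rightarrow> real" where
  "rest_ind x = (if fst x \<in> {fst u, fst v} then 0 else 1)"

text \<open>
  A function that is antisymmetric under the exchange of the two parts that meet the edge, vanishes
  on the other parts and is constant on the part of u away from u is given by its values x at u and
  y on the rest of that part. It belongs to the eigenvalue l iff - a (p - 1) y = l x and
  - a x - b (p - 1) y = l y. The choice x = a (p - 1), y = - l solves the
  first equation and turns the second into a quadratic equation for l.
\<close>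
definition skew :: "real \<Rightarrow> nat \<times> nat \<Rightarrow> real" where
  "skew l x = (if x = u then a * (real p - 1) else if x = v then - (a * (real p - 1))
     else if fst x = fst u then - l else if fst x = fst v then l else 0)"
definition part_diff :: "nat \<Rightarrow> nat \<Rightarrow> nat \<times> nat \<Rightarrow> real" where
  "part_diff q j x = (if fst x = j then 1 else if fst x = q then - 1 else 0)"

text \<open>
  A vertex other than u and v in each part: one of the first two vertices is available.
\<close>
definition rep :: "nat \<Rightarrow> nat \<times> nat" where
  "rep i = (i, if i = fst u \<and> snd u = 0 \<or> i = fst v \<and> snd v = 0 then 1 else 0)"
definition twin_diff :: "nat \<times> nat \<Rightarrow> nat \<times> nat \<Rightarrow> real" where
  "twin_diff w x = (if x = w then 1 else 0) - (if x = rep (fst w) then 1 else 0)"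

definition others :: "nat set" where "others = {..<t} - {fst u, fst v}"

lemma card_others: "card others = t - 2"
  using fst_uv uv by (simp add: others_def card_Diff_subset)

lemma rep_ordinary: "rep i \<in> ordinary" if "i < t"
  using that p2 uv unfolding rep_def ordinary_def V_def by (auto simp: prod_eq_iff)

lemma sum_parts:
  "(\<Sum>i<t. part_size i * c i) = (real p - 1) * (c (fst u) + c (fst v)) + real p * (\<Sum>i\<in>others. c i)"
proof -
  have "(\<Sum>i<t. part_size i * c i) = (\<Sum>i<t. if i = fst u then (real p - 1) * c (fst u)
      else if i = fst v then (real p - 1) * c (fst v) else real p * c i)"
    by (intro sum.cong) (auto simp: part_size_def)
  then show ?thesis
    using sum_lessThan_if2[OF fst_uv uv] by (simp add: others_def sum_distrib_left algebra_simps)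
qed

text \<open>
  Column j holds the coefficients of the image of the j-th of \<open>pair_ind\<close>, \<open>cut_ind\<close>, \<open>rest_ind\<close>;
  since these are indicators of a partition, it can also be read off row by row as the quotient
  matrix of that partition.
\<close>
definition M :: "real mat" where
  "M = mat_of_rows_list 3
          [[0,     a * (real p - 1),     a * real p * (real t - 2)],
           [a,     b * (real p - 1),     b * real p * (real t - 2)],
           [2 * a, 2 * b * (real p - 1), b * real p * (real t - 3)]]"

lemma weight_pair_ind:
  assumes "w \<in> V"
  shows "(\<Sum>x\<in>V. weight w x * pair_ind x) = a * cut_ind w + 2 * a * rest_ind w"
  using weight_sum_partwise[of pair_ind "\<lambda>_. 0" 0, OF _ _ assms] uv
  by (auto simp: pair_ind_def cut_ind_def rest_ind_def ordinary_def)

lemma weight_cut_ind: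
  assumes "w \<in> V"
  shows "(\<Sum>x\<in>V. weight w x * cut_ind x) =
    (real p - 1) * (a * pair_ind w + b * cut_ind w + 2 * b * rest_ind w)"
proof -
  define c where "c i = (if i \<in> {fst u, fst v} then 1 else 0 :: real)" for i
  have "(\<Sum>i\<in>others. c i) = 0" by (intro sum.neutral) (auto simp: c_def others_def)
  then have tot: "(\<Sum>i<t. part_size i * c i) = 2 * (real p - 1)" by (simp add: sum_parts c_def)
  then show ?thesis
    using weight_sum_partwise[of cut_ind c, OF _ tot assms] uv
    by (auto simp: pair_ind_def cut_ind_def rest_ind_def ordinary_def c_def part_size_def algebra_simps)
qed

lemma weight_rest_ind:
  assumes "w \<in> V"
  shows "(\<Sum>x\<in>V. weight w x * rest_ind x) =
    a * real p * (real t - 2) * pair_ind w + b * real p * (real t - 2) * cut_ind w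
      + b * real p * (real t - 3) * rest_ind w"
proof -
  define c where "c i = (if i \<in> {fst u, fst v} then 0 else 1 :: real)" for i
  have "(\<Sum>i\<in>others. c i) = (\<Sum>i\<in>others. 1)" by (intro sum.cong) (auto simp: c_def others_def)
  then have tot: "(\<Sum>i<t. part_size i * c i) = real p * (real t - 2)"
    using t3 by (simp add: sum_parts c_def card_others)
  then show ?thesis
    using weight_sum_partwise[of rest_ind c, OF _ tot assms] uv
    by (auto simp: pair_ind_def cut_ind_def rest_ind_def ordinary_def c_def part_size_def algebra_simps)
qed

lemma weight_skew:
  assumes "w \<in> V" and l: "l\<^sup>2 + b * (real p - 1) * l = a\<^sup>2 * (real p - 1)"
  shows "(\<Sum>x\<in>V. weight w x * skew l x) = l * skew l w"
proof -
  define c where "c i = (if i = fst u then - l else if i = fst v then l else 0)" for i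
  have "(\<Sum>i\<in>others. c i) = 0" by (intro sum.neutral) (auto simp: c_def others_def)
  then have tot: "(\<Sum>i<t. part_size i * c i) = 0" using uv by (simp add: sum_parts c_def)
  then have "(\<Sum>x\<in>V. weight w x * skew l x) =
    (if w = u then a * ((real p - 1) * l)
     else if w = v then - (a * ((real p - 1) * l))
     else if fst w = fst u then - (l\<^sup>2)
     else if fst w = fst v then l\<^sup>2 else 0)"
    using weight_sum_partwise[of "skew l" c, OF _ tot assms(1)] uv uv_neq l
    by (auto simp: skew_def ordinary_def c_def part_size_def algebra_simps power2_eq_square)
  then show ?thesis using uv uv_neq by (simp add: skew_def power2_eq_square)
qed

lemma weight_part_diff:
  assumes "w \<in> V" and "q \<in> others" "j \<in> others" "j \<noteq> q"
  shows "(\<Sum>x\<in>V. weight w x * part_diff q j x) = - b * real p * part_diff q j w"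
proof -
  define c where "c i = (if i = j then 1 else if i = q then - 1 else 0 :: real)" for i
  have "(\<Sum>i\<in>others. c i) = (\<Sum>i\<in>others. (if i = j then 1 else 0) - (if i = q then 1 else 0))"
    using assms by (intro sum.cong) (auto simp: c_def)
  also have "\<dots> = 0" using assms by (simp add: sum_subtractf others_def)
  finally have tot: "(\<Sum>i<t. part_size i * c i) = 0" using assms by (simp add: sum_parts c_def others_def)
  then show ?thesis
    using weight_sum_partwise[of "part_diff q j" c, OF _ tot assms(1)] assms
    by (auto simp: part_diff_def ordinary_def others_def c_def part_size_def)
qed

lemma sum_twin_diff:
  assumes "w \<in> ordinary"
  shows "(\<Sum>x\<in>V. y x * twin_diff w x) = y w - y (rep (fst w))"
proof -
  have "rep (fst w) \<in> V" "w \<in> V"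
    using rep_ordinary[of "fst w"] assms by (auto simp: ordinary_def V_def)
  moreover have "(\<Sum>x\<in>V. y x * twin_diff w x) =
      (\<Sum>x\<in>V. (if x = w then y x else 0) - (if x = rep (fst w) then y x else 0))"
    by (intro sum.cong) (auto simp: twin_diff_def)
  ultimately show ?thesis using finite_V by (simp add: sum_subtractf)
qed

lemma weight_twin_diff:
  assumes "w \<in> ordinary"
  shows "(\<Sum>x\<in>V. weight z x * twin_diff w x) = 0"
proof -
  have "fst w < t" using assms by (auto simp: ordinary_def V_def)
  then show ?thesis
    unfolding sum_twin_diff[OF assms]
    using assms rep_ordinary[of "fst w"] by (auto simp: weight_def ordinary_def rep_def)
qed

text \<open>
  The twin differences reduce y to its values at u and v and one value per part. The orbit
  indicators \<open>pair_ind\<close> and \<open>cut_ind\<close> make y antisymmetric on the two parts that meet the edge, and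
  the skew functions kill the antisymmetric functions there. The differences of parts make the
  values on the other parts equal, hence 0 by \<open>rest_ind\<close>.
\<close>
lemma orthogonal_to_basis_imp_zero:
  assumes pair: "(\<Sum>x\<in>V. y x * pair_ind x) = 0" and cut: "(\<Sum>x\<in>V. y x * cut_ind x) = 0"
    and rest: "(\<Sum>x\<in>V. y x * rest_ind x) = 0"
    and skew: "(\<Sum>x\<in>V. y x * skew l x) = 0" "(\<Sum>x\<in>V. y x * skew l' x) = 0" and "l \<noteq> l'"
    and q: "q \<in> others" and part: "\<And>j. j \<in> others - {q} \<Longrightarrow> (\<Sum>x\<in>V. y x * part_diff q j x) = 0"
    and twin: "\<And>w. w \<in> ordinary - rep ` {..<t} \<Longrightarrow> (\<Sum>x\<in>V. y x * twin_diff w x) = 0"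
    and w: "w \<in> V"
  shows "y w = 0"
proof -
  \<comment> \<open>Orthogonality to the twin differences makes y constant on each part away from u and v.\<close>
  define c where "c i = y (rep i)" for i
  have p1: "real p - 1 \<noteq> 0" "real p \<noteq> 0" using p2 by auto
  have y: "y x = c (fst x)" if x: "x \<in> ordinary" for x
  proof (cases "x \<in> rep ` {..<t}")
    case True
    then show ?thesis by (auto simp: c_def rep_def)
  next
    case False
    then show ?thesis using twin[of x] x by (simp add: sum_twin_diff c_def)
  qed
  have S: "(\<Sum>x\<in>V. y x * f x) = y u * f u + y v * f v
      + (real p - 1) * (c (fst u) * d (fst u) + c (fst v) * d (fst v)) + real p * (\<Sum>i\<in>others. c i * d i)"
    if "\<And>x. x \<in> ordinary \<Longrightarrow> f x = d (fst x)" for f d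
    using sum_partwise[of "\<lambda>x. y x * f x" "\<lambda>i. c i * d i"] sum_parts[of "\<lambda>i. c i * d i"] that y by simp
  have 1: "y u + y v = 0"
    using pair S[of pair_ind "\<lambda>_. 0"] by (auto simp: pair_ind_def ordinary_def)
  have "(\<Sum>i\<in>others. c i * (if i \<in> {fst u, fst v} then 1 else 0)) = 0"
    by (intro sum.neutral) (auto simp: others_def)
  then have 2: "c (fst u) + c (fst v) = 0"
    using cut S[of cut_ind "\<lambda>i. if i \<in> {fst u, fst v} then 1 else 0"] p1
    by (auto simp: cut_ind_def ordinary_def)
  have 3: "a * (y u - y v) = m * (c (fst u) - c (fst v))" if "(\<Sum>x\<in>V. y x * skew m x) = 0" for m
  proof -
    define d where "d i = (if i = fst u then - m else if i = fst v then m else 0)" for i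
    have "(\<Sum>i\<in>others. c i * d i) = 0" by (intro sum.neutral) (auto simp: others_def d_def)
    moreover have "skew m x = d (fst x)" if "x \<in> ordinary" for x
      using that by (auto simp: skew_def d_def ordinary_def)
    ultimately have "(real p - 1) * (a * (y u - y v) - m * (c (fst u) - c (fst v))) = 0"
      using that S[of "skew m" d] uv uv_neq by (simp add: skew_def d_def algebra_simps)
    then show ?thesis using p1 by simp
  qed
  \<comment> \<open>The left-hand side of 3 does not depend on m, and there are two different values of m.\<close>
  from 3[OF skew(1)] 3[OF skew(2)] \<open>l \<noteq> l'\<close> have 4: "c (fst u) = c (fst v)" by auto
  with 3[OF skew(1)] a_pos have 5: "y u = y v" by simp
  have 6: "c j = c q" if j: "j \<in> others" for j
  proof (cases "j = q")
    case False
    define d where "d i = (if i = j then 1 else if i = q then - 1 else 0 :: real)" for i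
    have "(\<Sum>i\<in>others. c i * d i) = (\<Sum>i\<in>others. (if i = j then c i else 0) - (if i = q then c i else 0))"
      using False by (intro sum.cong) (auto simp: d_def)
    also have "\<dots> = c j - c q" using q j by (simp add: sum_subtractf others_def)
    finally have "(\<Sum>i\<in>others. c i * d i) = c j - c q" .
    moreover have "part_diff q j x = d (fst x)" for x by (simp add: part_diff_def d_def)
    ultimately show ?thesis
      using part[of j] S[of "part_diff q j" d] j q False p1 by (auto simp: d_def others_def)
  qed simp
  have "(\<Sum>i\<in>others. c i * (if i \<in> {fst u, fst v} then 0 else 1)) = (\<Sum>i\<in>others. c q)"
    using 6 by (intro sum.cong) (auto simp: others_def)
  then have "c q = 0"
    using rest S[of rest_ind "\<lambda>i. if i \<in> {fst u, fst v} then 0 else 1"] p1 t3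
    by (auto simp: rest_ind_def ordinary_def card_others)
  then have "c i = 0" if "i < t" for i
    using 2 4 6[of i] that by (cases "i \<in> others") (auto simp: others_def)
  moreover have "fst w < t" using w by (auto simp: V_def)
  ultimately show ?thesis using 1 5 y[of w] w by (cases "w \<in> {u, v}") (auto simp: ordinary_def)
qed

section \<open>The ISI matrix of the graph and its characteristic polynomial\<close>

abbreviation G where "G \<equiv> delete_edge (complete_multipartite t p) {u, v}"

lemma verts_G: "verts G = V"
  by (simp add: delete_edge_def complete_multipartite_def V_def Let_def)

lemma adjacent_G:
  assumes "w \<in> V" "x \<in> V"
  shows "adjacent G w x \<longleftrightarrow> fst w \<noteq> fst x \<and> {w, x} \<noteq> {u, v}"
proof -
  have "{w, x} \<in> edges (complete_multipartite t p) \<longleftrightarrow> fst w \<noteq> fst x"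
  proof
    assume "fst w \<noteq> fst x"
    then show "{w, x} \<in> edges (complete_multipartite t p)"
      using assms unfolding complete_multipartite_def V_def Let_def snd_conv mem_Collect_eq
      by (intro exI[of _ w] exI[of _ x]) simp
  qed (auto simp: complete_multipartite_def Let_def doubleton_eq_iff)
  then show ?thesis by (simp add: adjacent_def delete_edge_def)
qed

lemma degree_G:
  assumes "w \<in> V"
  shows "real (vdegree G w) = (if w \<in> {u, v} then r - 1 else r)"
proof -
  define A where "A = ({..<t} - {fst w}) \<times> {..<p}"
  \<comment> \<open>The neighbours of w before the edge is deleted.\<close>
  have "card A = (t - 1) * p" using assms by (auto simp: A_def V_def card_cartesian_product)
  then have A: "real (card A) = r" using t3 by (simp add: r_def of_nat_diff)
  have "finite A" by (simp add: A_def)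
  have "{x \<in> V. adjacent G w x} = A - (if w = u then {v} else if w = v then {u} else {})"
    using assms adjacent_G[OF assms] uv_neq
    by (auto simp: A_def V_def doubleton_eq_iff)
  moreover have "v \<in> A" if "w = u" using that uv v by (auto simp: A_def mem_Times_iff)
  moreover have "u \<in> A" if "w = v" using that uv u by (auto simp: A_def mem_Times_iff)
  moreover have "real (card (A - {x})) = r - 1" if "x \<in> A" for x
    using A \<open>finite A\<close> that card_gt_0_iff[of A] by (auto simp: card_Diff_singleton of_nat_diff Suc_le_eq)
  ultimately show ?thesis using A uv_neq unfolding vdegree_def verts_G by (simp split: if_splits)
qed

lemma ISI_G:
  assumes "set vs = V"
  shows "ISI G vs = mat (length vs) (length vs) (\<lambda>(i, j). weight (vs ! i) (vs ! j))"
proof -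
  have "(if adjacent G w x
      then real (vdegree G w) * real (vdegree G x) / (real (vdegree G w) + real (vdegree G x)) else 0)
      = weight w x" if "w \<in> V" "x \<in> V" for w x
    using that uv r_ge
    by (auto simp: adjacent_G degree_G weight_def a_def b_def doubleton_eq_iff algebra_simps)
  then show ?thesis
    unfolding ISI_def using assms nth_mem[of _ vs] by (intro cong_mat) (simp_all split del: if_split)
qed

lemma det_M: "det M = a\<^sup>2 * b * real p * (real p - 1) * (real t - 1)"
  unfolding M_def det_mat_of_rows_list_3 by (simp add: power2_eq_square algebra_simps)

lemma det_M_pos: "det M > 0"
  unfolding det_M using a_pos b_pos p2 t3 by simp

lemma M_carrier: "M \<in> carrier_mat 3 3"
  by (auto simp: M_def mat_of_rows_list_def)

text \<open>
  The hypotheses on lp and lm say that they are the two roots of the quadratic equation that makes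
  \<open>skew\<close> an eigenfunction.
\<close>
theorem char_poly_ISI:
  assumes vs: "distinct vs" "set vs = V"
    and lp: "lp\<^sup>2 + b * (real p - 1) * lp = a\<^sup>2 * (real p - 1)"
    and lm: "lm\<^sup>2 + b * (real p - 1) * lm = a\<^sup>2 * (real p - 1)"
    and "lp \<noteq> lm"
  shows "char_poly (ISI G vs) = char_poly M *
    (\<Prod>d\<leftarrow>[lp, lm] @ replicate (t - 3) (- b * real p) @ replicate (p * t - t - 2) 0. [:- d, 1:])"
proof -
  have "others \<noteq> {}" using card_others t3 by auto
  then obtain q where q: "q \<in> others" by auto
  obtain qs where qs: "set qs = others - {q}" "length qs = t - 3"
  proof -
    have "finite (others - {q})" "card (others - {q}) = t - 3"
      using q card_others by (auto simp: others_def)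
    then show ?thesis using that finite_distinct_list[of "others - {q}"] distinct_card by metis
  qed
  obtain ws where ws: "set ws = ordinary - rep ` {..<t}" "length ws = p * t - t - 2"
  proof -
    have fin: "finite ordinary" using finite_V by (simp add: ordinary_def)
    have "card ordinary = p * t - 2"
      using uv_V uv_neq finite_V by (simp add: ordinary_def card_Diff_subset V_def mult.commute)
    moreover have "card (rep ` {..<t}) = t"
      by (subst card_image) (auto simp: inj_on_def rep_def)
    ultimately have "card (ordinary - rep ` {..<t}) = p * t - t - 2"
      using rep_ordinary by (subst card_Diff_subset) auto
    then show ?thesis
      using that fin finite_distinct_list[of "ordinary - rep ` {..<t}"] distinct_card
      by (metis finite_Diff)
  qed
  define bs where "bs = [pair_ind, cut_ind, rest_ind]"
  define ds where "ds = [(lp, skew lp), (lm, skew lm)]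
    @ map (\<lambda>j. (- b * real p, part_diff q j)) qs @ map (\<lambda>w. (0, twin_diff w)) ws"
  have "length vs = p * t" using distinct_card[OF vs(1)] vs(2) by (simp add: V_def mult.commute)
  moreover have "2 * t \<le> p * t" using p2 by simp
  moreover have "length bs + length ds = 3 + (2 + (t - 3) + (p * t - t - 2))"
    using qs ws by (simp add: bs_def ds_def)
  ultimately have len: "length bs + length ds = length vs" using t3 by linarith
  have ev: "map fst ds = [lp, lm] @ replicate (t - 3) (- b * real p) @ replicate (p * t - t - 2) 0"
    using qs ws by (simp add: ds_def o_def map_replicate_const)
  have "char_poly (mat (length vs) (length vs) (\<lambda>(i, j). weight (vs ! i) (vs ! j)))
      = char_poly M * (\<Prod>d\<leftarrow>map fst ds. [:- d, 1:])"
  proof (rule char_poly_invariant_block_eigenfunctions[where bs = bs, OF vs(1) len])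
    show "M \<in> carrier_mat (length bs) (length bs)" using M_carrier by (simp add: bs_def numeral_3_eq_3)
  next
    fix j w assume "j < length bs" and w: "w \<in> set vs"
    then consider "j = 0" | "j = 1" | "j = 2" by (fastforce simp: bs_def)
    then show "(\<Sum>x\<in>set vs. weight w x * (bs ! j) x) = (\<Sum>l<length bs. (bs ! l) w * M $$ (l, j))"
      using w vs(2) weight_pair_ind[of w] weight_cut_ind[of w] weight_rest_ind[of w]
      by cases (simp_all add: bs_def lessThan_Suc M_def mat_of_rows_list_def algebra_simps)
  next
    fix d f w assume "(d, f) \<in> set ds" "w \<in> set vs"
    then show "(\<Sum>x\<in>set vs. weight w x * f x) = d * f w"
      using vs qs ws weight_skew[of w, OF _ lp] weight_skew[of w, OF _ lm]
        weight_part_diff[of w, OF _ q] weight_twin_diff[of _ w]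
      by (auto simp: ds_def simp del: split_paired_All)
  next
    fix y w
    assume orth: "\<And>f. f \<in> set bs \<union> snd ` set ds \<Longrightarrow> (\<Sum>x\<in>set vs. y x * f x) = 0"
      and w: "w \<in> set vs"
    note 0 = orth[unfolded vs(2)]
    show "y w = 0"
    proof (rule orthogonal_to_basis_imp_zero[where l = lp and l' = lm and q = q])
      fix j assume "j \<in> others - {q}"
      then have "(- b * real p, part_diff q j) \<in> set ds" using qs by (simp add: ds_def)
      then show "(\<Sum>x\<in>V. y x * part_diff q j x) = 0" by (intro 0) force
    next
      fix z assume "z \<in> ordinary - rep ` {..<t}"
      then have "(0, twin_diff z) \<in> set ds" using ws by (simp add: ds_def)
      then show "(\<Sum>x\<in>V. y x * twin_diff z x) = 0" by (intro 0) force
    next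
      show "w \<in> V" using w vs(2) by simp
    qed (use \<open>lp \<noteq> lm\<close> q in \<open>simp_all add: 0 bs_def ds_def\<close>)
  qed
  then show ?thesis unfolding ISI_G[OF vs(2)] ev .
qed

end

section \<open>The spectrum\<close>

theorem theorem3p7:
  fixes t p :: nat
    and e :: "(nat \<times> nat) set"
    and vs :: "(nat \<times> nat) list"
    and G :: "(nat \<times> nat) graph"
    and r a b lp lm :: real
    and M :: "real mat"
  assumes "t \<ge> 3" and "p \<ge> 2"
    and "e \<in> edges (complete_multipartite t p)"
    and "G = delete_edge (complete_multipartite t p) e"
    and "distinct vs" and "set vs = verts G"
    and "r = real p * (real t - 1)"
    and "a = r * (r - 1) / (2 * r - 1)"
    and "b = r / 2"
    and "lp = (- b * (real p - 1) + sqrt (b\<^sup>2 * (real p - 1)\<^sup>2 + 4 * a\<^sup>2 * (real p - 1))) / 2"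
    and "lm = (- b * (real p - 1) - sqrt (b\<^sup>2 * (real p - 1)\<^sup>2 + 4 * a\<^sup>2 * (real p - 1))) / 2"
    and "M = mat_of_rows_list 3
          [[0,     a * (real p - 1),     a * real p * (real t - 2)],
           [a,     b * (real p - 1),     b * real p * (real t - 2)],
           [2 * a, 2 * b * (real p - 1), b * real p * (real t - 3)]]"
  shows "(\<exists>\<mu>1 \<mu>2 \<mu>3.
            Spec M = {#\<mu>1, \<mu>2, \<mu>3#} \<and>
            Spec (ISI G vs) =
              replicate_mset (p * t - t - 2) 0
              + replicate_mset (t - 3) (complex_of_real (- b * real p))
              + {#complex_of_real lp, complex_of_real lm, \<mu>1, \<mu>2, \<mu>3#} \<and>
            \<mu>1 \<noteq> 0 \<and> \<mu>2 \<noteq> 0 \<and> \<mu>3 \<noteq> 0)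
       \<and> det M = real p ^ 4 * (real p - 1) * (real t - 1) ^ 4 * (real p * real t - real p - 1)\<^sup>2
                  / (2 * (2 * real p * real t - 2 * real p - 1)\<^sup>2)
       \<and> det M > 0"
proof -
  obtain u v where e: "e = {u, v}" and u: "u \<in> {..<t} \<times> {..<p}" and v: "v \<in> {..<t} \<times> {..<p}"
    and uv: "fst u \<noteq> fst v"
    using assms(3) unfolding complete_multipartite_def Let_def by auto
  interpret g: multipartite_minus_edge t p u v
    by unfold_locales (use assms u v uv in auto)
  have r: "r = g.r" using assms by (simp add: g.r_def)
  have a: "a = g.a" using assms r by (simp add: g.a_def)
  have b: "b = g.b" using assms r by (simp add: g.b_def)
  have M: "M = g.M" using assms a b by (simp add: g.M_def)
  have G: "G = g.G" using assms e by simp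
  \<comment> \<open>Both lp and lm are roots of x^2 + \<beta> x - \<gamma>, and they differ as the discriminant is positive.\<close>
  define \<beta> \<gamma> where "\<beta> = b * (real p - 1)" and "\<gamma> = a\<^sup>2 * (real p - 1)"
  have disc: "\<beta>\<^sup>2 + 4 * \<gamma> > 0"
    using g.a_pos g.p2 a by (intro add_nonneg_pos) (auto simp: \<gamma>_def)
  have disc_eq: "b\<^sup>2 * (real p - 1)\<^sup>2 + 4 * a\<^sup>2 * (real p - 1) = \<beta>\<^sup>2 + 4 * \<gamma>"
    by (simp add: \<beta>_def \<gamma>_def power_mult_distrib)
  have lp: "lp\<^sup>2 + \<beta> * lp = \<gamma>"
    using disc unfolding assms(10) disc_eq by (intro quadratic_roots[where s = 1]) (auto simp: \<beta>_def)
  have lm: "lm\<^sup>2 + \<beta> * lm = \<gamma>"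
    using disc unfolding assms(11) disc_eq by (intro quadratic_roots[where s = "-1"]) (auto simp: \<beta>_def)
  have "lp - lm = sqrt (\<beta>\<^sup>2 + 4 * \<gamma>)"
    unfolding assms(10,11) disc_eq by (simp add: field_simps)
  then have "lp \<noteq> lm" using disc by auto
  then have "char_poly (ISI G vs) = char_poly M *
    (\<Prod>d\<leftarrow>[lp, lm] @ replicate (t - 3) (- b * real p) @ replicate (p * t - t - 2) 0. [:- d, 1:])"
    using g.char_poly_ISI[of vs lp lm] lp lm assms(5,6) unfolding G M a b \<beta>_def \<gamma>_def g.verts_G by blast
  moreover have "ISI G vs \<in> carrier_mat (length vs) (length vs)" by (simp add: ISI_def)
  ultimately have Spec: "Spec (ISI G vs) = Spec M + mset (map complex_of_real
    ([lp, lm] @ replicate (t - 3) (- b * real p) @ replicate (p * t - t - 2) 0))"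
    using Spec_if_char_poly_factors g.M_carrier M by blast
  obtain \<mu>1 \<mu>2 \<mu>3 where \<mu>: "Spec M = {#\<mu>1, \<mu>2, \<mu>3#}"
    using Spec_3 g.M_carrier M by metis
  have pos: "det M > 0" using g.det_M_pos M by simp
  then have nz: "0 \<notin># Spec M" using det_0_if_0_in_Spec[OF g.M_carrier] M by auto
  have "det M = a\<^sup>2 * b * real p * (real p - 1) * (real t - 1)" using g.det_M M a b by simp
  also have "\<dots> = r\<^sup>2 * (r - 1)\<^sup>2 / (2 * r - 1)\<^sup>2 * (r / 2) * real p * (real p - 1) * (real t - 1)"
    unfolding assms(8,9) by (simp add: power_divide power_mult_distrib)
  also have "\<dots> = r ^ 3 * (real p * (real p - 1) * (real t - 1)) * (r - 1)\<^sup>2 / (2 * (2 * r - 1)\<^sup>2)"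
    by (simp add: power2_eq_square power3_eq_cube mult_ac)
  also have "r ^ 3 * (real p * (real p - 1) * (real t - 1)) = real p ^ 4 * (real p - 1) * (real t - 1) ^ 4"
    unfolding assms(7) by (simp add: power_mult_distrib eval_nat_numeral)
  also have "r - 1 = real p * real t - real p - 1" unfolding assms(7) by (simp add: algebra_simps)
  also have "2 * r - 1 = 2 * real p * real t - 2 * real p - 1" unfolding assms(7) by (simp add: algebra_simps)
  finally have "det M = real p ^ 4 * (real p - 1) * (real t - 1) ^ 4 * (real p * real t - real p - 1)\<^sup>2
                  / (2 * (2 * real p * real t - 2 * real p - 1)\<^sup>2)" .
  moreover have "Spec (ISI G vs) = replicate_mset (p * t - t - 2) 0
              + replicate_mset (t - 3) (complex_of_real (- b * real p))
              + {#complex_of_real lp, complex_of_real lm, \<mu>1, \<mu>2, \<mu>3#}"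
    unfolding Spec \<mu> by (simp add: ac_simps)
  ultimately show ?thesis using \<mu> nz pos by auto
qed

end
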